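(* Let $\alpha_0,\alpha_1\in\mathbb{C}$. The rational transformations $$x=u,\qquad y=\frac{du}{dt},\qquad z=\frac{\dfrac{d^2u}{dt^2}-\dfrac{(2\alpha_1-1)u+\alpha_0}{t^2}}{\dfrac{du}{dt}}$$ take the third-order equation (equivalently, the first-order system of rational type in $(u,\frac{du}{dt},\frac{d^2u}{dt^2})$ associated with it) $$\frac{d^3u}{dt^3}=\frac{1}{2t^4\frac{du}{dt}}\left(t^2\frac{d^2u}{dt^2}-(2\alpha_1-1)u-\alpha_0\right)\left(t^2\frac{d^2u}{dt^2}+(2\alpha_1-1)u+\alpha_0\right)-\frac{4\frac{du}{dt}\left(u+t\frac{du}{dt}\right)}{t}+\frac{4t+(2\alpha_1-1)^2}{2t^2}\frac{du}{dt}-\frac2t\frac{d^2u}{dt^2}$$ to the system of polynomial type $$\frac{dx}{dt}=y,\qquad \frac{dy}{dt}=yz+\frac{2\alpha_1-1}{t^2}x+\frac{\alpha_0}{t^2},$$ $$\frac{dz}{dt}=-\frac12 z^2-\frac4t x-4y-\frac2t z+\frac{(2\alpha_1-1)(2\alpha_1-3)}{2t^2}+\frac2t .$$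
   Context: The equation is considered where $t\neq0$ and $\frac{du}{dt}\neq0$, so that its right-hand side and the transformation are defined. *)

theory Defs
  imports "HOL-Complex_Analysis.Complex_Analysis"
begin

text \<open>
  The independent variable \<open>t\<close> is complex. In the definitions below \<open>u\<close>, \<open>p\<close>, \<open>q\<close> stand for the
  values of \<open>u\<close>, \<open>du/dt\<close>, \<open>d\<^sup>2u/dt\<^sup>2\<close> at \<open>t\<close>. The formulas are meant for \<open>t \<noteq> 0\<close> and \<open>p \<noteq> 0\<close> only,
  since division by zero is totalised.
\<close>

definition eq3_rhs :: "complex \<Rightarrow> complex \<Rightarrow> complex \<Rightarrow> complex \<Rightarrow> complex \<Rightarrow> complex \<Rightarrow> complex" where
  "eq3_rhs \<alpha>0 \<alpha>1 t u p q =
     1 / (2 * t^4 * p) * (t^2 * q - (2 * \<alpha>1 - 1) * u - \<alpha>0) * (t^2 * q + (2 * \<alpha>1 - 1) * u + \<alpha>0)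
     - 4 * p * (u + t * p) / t
     + (4 * t + (2 * \<alpha>1 - 1)^2) / (2 * t^2) * p
     - 2 / t * q"

definition solves_eq3 :: "complex \<Rightarrow> complex \<Rightarrow> complex set \<Rightarrow> (complex \<Rightarrow> complex) \<Rightarrow> bool" where
  "solves_eq3 \<alpha>0 \<alpha>1 S u \<longleftrightarrow>
     (\<forall>t\<in>S. (deriv ^^ 3) u t = eq3_rhs \<alpha>0 \<alpha>1 t (u t) (deriv u t) ((deriv ^^ 2) u t))"

definition solves_rational_system ::
  "complex \<Rightarrow> complex \<Rightarrow> complex set \<Rightarrow>
   (complex \<Rightarrow> complex) \<Rightarrow> (complex \<Rightarrow> complex) \<Rightarrow> (complex \<Rightarrow> complex) \<Rightarrow> bool" where
  "solves_rational_system \<alpha>0 \<alpha>1 S u p q \<longleftrightarrow>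
     (\<forall>t\<in>S. (u has_field_derivative p t) (at t)
          \<and> (p has_field_derivative q t) (at t)
          \<and> (q has_field_derivative eq3_rhs \<alpha>0 \<alpha>1 t (u t) (p t) (q t)) (at t))"

definition solves_polynomial_system ::
  "complex \<Rightarrow> complex \<Rightarrow> complex set \<Rightarrow>
   (complex \<Rightarrow> complex) \<Rightarrow> (complex \<Rightarrow> complex) \<Rightarrow> (complex \<Rightarrow> complex) \<Rightarrow> bool" where
  "solves_polynomial_system \<alpha>0 \<alpha>1 S x y z \<longleftrightarrow>
     (\<forall>t\<in>S. (x has_field_derivative y t) (at t)
          \<and> (y has_field_derivative
               y t * z t + (2 * \<alpha>1 - 1) / t^2 * x t + \<alpha>0 / t^2) (at t)
          \<and> (z has_field_derivative
               - (1 / 2) * (z t)^2 - 4 / t * x t - 4 * y t - 2 / t * z t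
               + (2 * \<alpha>1 - 1) * (2 * \<alpha>1 - 3) / (2 * t^2) + 2 / t) (at t))"

text \<open>The third component of the transformation; the first two are \<open>x = u\<close> and \<open>y = p\<close>.\<close>

definition transf_z :: "complex \<Rightarrow> complex \<Rightarrow> complex \<Rightarrow> complex \<Rightarrow> complex \<Rightarrow> complex \<Rightarrow> complex" where
  "transf_z \<alpha>0 \<alpha>1 t u p q = (q - ((2 * \<alpha>1 - 1) * u + \<alpha>0) / t^2) / p"

end

theory Submission imports Defs begin

text \<open>
  Write \<open>L = (2 * \<alpha>1 - 1) * u + \<alpha>0\<close>. Because \<open>p \<noteq> 0\<close>, the formula for \<open>z\<close> can be solved for the second
  derivative: it says \<open>q = p * z + L / t^2\<close>. So for fixed \<open>t\<close> the transformation is an invertible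
  change of coordinates between \<open>(u, p, q)\<close> and \<open>(u, p, z)\<close>, and the second polynomial equation is
  just the equation \<open>p' = q\<close> in the new coordinates. Differentiating \<open>q = p * z + L / t^2\<close>
  along \<open>u' = p\<close>, \<open>p' = q\<close> gives
  \<open>q' = p * z' + q * z + (2 * \<alpha>1 - 1) * p / t^2 - 2 * L / t^3\<close>, which determines \<open>q'\<close> from \<open>z'\<close> and,
  dividing by \<open>p\<close>, also \<open>z'\<close> from \<open>q'\<close>. Substituting the polynomial expression for \<open>z'\<close> yields the
  right-hand side of the third-order equation (\<open>eq3_rhs_transformed\<close>): the product in its first
  term factors as \<open>t^4 * (q - L / t^2) * (q + L / t^2) = t^4 * p * z * (p * z + 2 * L / t^2)\<close>, so that
  the denominator \<open>p\<close> cancels. This is \<open>solves_rational_iff_polynomial\<close>.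

  The scalar equation and the rational first-order system are in turn equivalent for holomorphic
  \<open>u\<close>, since solutions on an open set have \<open>p\<close> and \<open>q\<close> as first and second derivative of \<open>u\<close>
  there, and holomorphic functions have all derivatives.
\<close>

definition poly_z_rhs ::
  "complex \<Rightarrow> complex \<Rightarrow> complex \<Rightarrow> complex \<Rightarrow> complex \<Rightarrow> complex" where
  "poly_z_rhs \<alpha>1 t x y z =
     - (1 / 2) * z^2 - 4 / t * x - 4 * y - 2 / t * z
     + (2 * \<alpha>1 - 1) * (2 * \<alpha>1 - 3) / (2 * t^2) + 2 / t"

lemma transf_z_eq_iff:
  assumes "p \<noteq> 0"
  shows "transf_z \<alpha>0 \<alpha>1 t u p q = z \<longleftrightarrow> q = p * z + ((2 * \<alpha>1 - 1) * u + \<alpha>0) / t^2"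
  using assms unfolding transf_z_def by (auto simp: divide_eq_eq algebra_simps)

text \<open>
  The right-hand side below is the derivative of \<open>p * z + ((2 * \<alpha>1 - 1) * u + \<alpha>0) / t^2\<close> along the
  polynomial system, so the identity says that the third-order equation is the third polynomial
  equation in the coordinates \<open>(u, p, q)\<close>.
\<close>
lemma eq3_rhs_transformed:
  assumes "t \<noteq> 0" "p \<noteq> 0"
    and q: "q = p * z + ((2 * \<alpha>1 - 1) * u + \<alpha>0) / t^2"
  shows "eq3_rhs \<alpha>0 \<alpha>1 t u p q =
    p * poly_z_rhs \<alpha>1 t u p z + q * z + (2 * \<alpha>1 - 1) * p / t^2
      - 2 * ((2 * \<alpha>1 - 1) * u + \<alpha>0) / t^3"
proof -
  define L where "L = (2 * \<alpha>1 - 1) * u + \<alpha>0"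
  have tq: "t^2 * q = t^2 * p * z + L"
    using assms(1) by (simp add: q L_def field_simps)
  have "(t^2 * q - (2 * \<alpha>1 - 1) * u - \<alpha>0) * (t^2 * q + (2 * \<alpha>1 - 1) * u + \<alpha>0)
      = (t^2 * q - L) * (t^2 * q + L)"
    by (simp add: L_def algebra_simps)
  also have "\<dots> = t^2 * p * z * (t^2 * p * z + 2 * L)"
    unfolding tq by (simp add: algebra_simps)
  finally have prod: "1 / (2 * t^4 * p) * (t^2 * q - (2 * \<alpha>1 - 1) * u - \<alpha>0)
      * (t^2 * q + (2 * \<alpha>1 - 1) * u + \<alpha>0) = p * z^2 / 2 + z * L / t^2"
    using assms(1,2) by (simp add: field_simps power2_eq_square power4_eq_xxxx)
  show ?thesis
    unfolding eq3_rhs_def prod poly_z_rhs_def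
    unfolding q L_def[symmetric]
    using assms(1) by (simp add: field_simps power2_eq_square power3_eq_cube)
qed

lemma has_field_derivative_affine_over_square:
  fixes u :: "complex \<Rightarrow> complex"
  assumes "t \<noteq> 0" "(u has_field_derivative p) (at t)"
  shows "((\<lambda>t. (b * u t + c) / t^2) has_field_derivative
      b * p / t^2 - 2 * (b * u t + c) / t^3) (at t)"
proof -
  have "t^2 \<noteq> 0"
    using assms(1) by simp
  have "((\<lambda>t. b * u t + c) has_field_derivative b * p) (at t)"
    using DERIV_add[OF DERIV_cmult[OF assms(2)] DERIV_const, of b c] by simp
  moreover have "((\<lambda>t. t^2) has_field_derivative 2 * t) (at t)"
    using DERIV_power[OF DERIV_ident, of 2] by simp
  ultimately have "((\<lambda>t. (b * u t + c) / t^2) has_field_derivative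
      ((b * p) * t^2 - (b * u t + c) * (2 * t)) / (t^2 * t^2)) (at t)"
    using \<open>t^2 \<noteq> 0\<close> by (rule DERIV_divide)
  also have "((b * p) * t^2 - (b * u t + c) * (2 * t)) / (t^2 * t^2)
      = b * p / t^2 - 2 * (b * u t + c) / t^3"
    using assms(1) by (simp add: field_simps power2_eq_square power3_eq_cube)
  finally show ?thesis .
qed

text \<open>
  The relation between \<open>q\<close> and \<open>z\<close> has to hold on all of the open set \<open>S\<close>, so that it can be
  differentiated: this transfers derivatives from \<open>z\<close> to \<open>q\<close>, and, since \<open>p\<close> has no zero, back.
\<close>
lemma solves_rational_iff_polynomial:
  assumes S: "open S" "0 \<notin> S"
    and p: "\<And>t. t \<in> S \<Longrightarrow> p t \<noteq> 0"
    and q: "\<And>t. t \<in> S \<Longrightarrow> q t = p t * z t + ((2 * \<alpha>1 - 1) * u t + \<alpha>0) / t^2"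
  shows "solves_rational_system \<alpha>0 \<alpha>1 S u p q \<longleftrightarrow> solves_polynomial_system \<alpha>0 \<alpha>1 S u p z"
proof -
  define L where "L = (\<lambda>t. ((2 * \<alpha>1 - 1) * u t + \<alpha>0) / t^2)"
  define dL where
    "dL = (\<lambda>t. (2 * \<alpha>1 - 1) * p t / t^2 - 2 * ((2 * \<alpha>1 - 1) * u t + \<alpha>0) / t^3)"
  have q': "q t = p t * z t + L t" if "t \<in> S" for t
    using q[OF that] by (simp add: L_def)
  have rhs: "eq3_rhs \<alpha>0 \<alpha>1 t (u t) (p t) (q t)
      = p t * poly_z_rhs \<alpha>1 t (u t) (p t) (z t) + q t * z t + dL t" if "t \<in> S" for t
    using eq3_rhs_transformed[OF _ p[OF that] q[OF that]] that S(2)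
    by (auto simp: dL_def add_diff_eq)
  have y_rhs: "p t * z t + (2 * \<alpha>1 - 1) / t^2 * u t + \<alpha>0 / t^2 = q t" if "t \<in> S" for t
    by (simp add: q[OF that] add_divide_distrib)
  have poly: "solves_polynomial_system \<alpha>0 \<alpha>1 S u p z \<longleftrightarrow>
      (\<forall>t\<in>S. (u has_field_derivative p t) (at t) \<and> (p has_field_derivative q t) (at t)
        \<and> (z has_field_derivative poly_z_rhs \<alpha>1 t (u t) (p t) (z t)) (at t))"
    unfolding solves_polynomial_system_def poly_z_rhs_def
    by (intro ball_cong refl) (simp only: y_rhs)
  have "(q has_field_derivative eq3_rhs \<alpha>0 \<alpha>1 t (u t) (p t) (q t)) (at t) \<longleftrightarrow>
      (z has_field_derivative poly_z_rhs \<alpha>1 t (u t) (p t) (z t)) (at t)"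
    if t: "t \<in> S" and du: "(u has_field_derivative p t) (at t)"
      and dp: "(p has_field_derivative q t) (at t)" for t
  proof
    have dL: "(L has_field_derivative dL t) (at t)"
      unfolding L_def dL_def
      by (rule has_field_derivative_affine_over_square[OF _ du]) (use t S(2) in auto)
    {
      assume "(z has_field_derivative poly_z_rhs \<alpha>1 t (u t) (p t) (z t)) (at t)"
      from DERIV_add[OF DERIV_mult[OF dp this] dL]
      have "((\<lambda>t. p t * z t + L t) has_field_derivative
          eq3_rhs \<alpha>0 \<alpha>1 t (u t) (p t) (q t)) (at t)"
        by (simp add: rhs[OF t] algebra_simps)
      then show "(q has_field_derivative eq3_rhs \<alpha>0 \<alpha>1 t (u t) (p t) (q t)) (at t)"
        by (rule has_field_derivative_transform_within_open[OF _ S(1) t]) (simp add: q')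
    next
      assume "(q has_field_derivative eq3_rhs \<alpha>0 \<alpha>1 t (u t) (p t) (q t)) (at t)"
      from DERIV_divide[OF DERIV_diff[OF this dL] dp p[OF t]]
      have "((\<lambda>t. (q t - L t) / p t) has_field_derivative
          ((eq3_rhs \<alpha>0 \<alpha>1 t (u t) (p t) (q t) - dL t) * p t - (q t - L t) * q t)
            / (p t * p t)) (at t)" .
      also have "((eq3_rhs \<alpha>0 \<alpha>1 t (u t) (p t) (q t) - dL t) * p t - (q t - L t) * q t)
            / (p t * p t) = poly_z_rhs \<alpha>1 t (u t) (p t) (z t)"
      proof -
        have 1: "q t - L t = p t * z t"
          by (simp add: q'[OF t])
        have 2: "eq3_rhs \<alpha>0 \<alpha>1 t (u t) (p t) (q t) - dL t
            = p t * poly_z_rhs \<alpha>1 t (u t) (p t) (z t) + q t * z t"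
          by (simp add: rhs[OF t])
        show ?thesis
          unfolding 1 2 using p[OF t] by (simp add: divide_eq_eq algebra_simps)
      qed
      finally show "(z has_field_derivative poly_z_rhs \<alpha>1 t (u t) (p t) (z t)) (at t)"
        by (rule has_field_derivative_transform_within_open[OF _ S(1) t]) (simp add: q' p)
    }
  qed
  then show ?thesis
    unfolding solves_rational_system_def poly by blast
qed

text \<open>
  The functions \<open>p\<close> and \<open>q\<close> are constrained on \<open>S\<close> only. As \<open>S\<close> is open, \<open>deriv u\<close> agrees with \<open>p\<close>
  near each point of \<open>S\<close>, which is what allows the iterated derivatives to be read off one by one.
\<close>
lemma solves_rational_imp_eq3:
  assumes "open S" and sol: "solves_rational_system \<alpha>0 \<alpha>1 S u p q"
  shows "u holomorphic_on S"
    and "\<And>t. t \<in> S \<Longrightarrow> deriv u t = p t"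
    and "\<And>t. t \<in> S \<Longrightarrow> (deriv ^^ 2) u t = q t"
    and "solves_eq3 \<alpha>0 \<alpha>1 S u"
proof -
  have du: "(u has_field_derivative p t) (at t)"
    and dp: "(p has_field_derivative q t) (at t)"
    and dq: "(q has_field_derivative eq3_rhs \<alpha>0 \<alpha>1 t (u t) (p t) (q t)) (at t)"
    if "t \<in> S" for t
    using sol that by (auto simp: solves_rational_system_def)
  show "u holomorphic_on S"
    using du \<open>open S\<close> by (auto simp: holomorphic_on_open)
  show d1: "deriv u t = p t" if "t \<in> S" for t
    using du[OF that] by (rule DERIV_imp_deriv)
  show d2: "(deriv ^^ 2) u t = q t" if "t \<in> S" for t
  proof -
    have "(deriv u has_field_derivative q t) (at t)"
      by (rule has_field_derivative_transform_within_open[OF dp[OF that] \<open>open S\<close> that])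
         (simp add: d1)
    then show ?thesis
      by (simp add: numeral_2_eq_2 DERIV_imp_deriv)
  qed
  have d3: "(deriv ^^ 3) u t = eq3_rhs \<alpha>0 \<alpha>1 t (u t) (p t) (q t)" if "t \<in> S" for t
  proof -
    have "((deriv ^^ 2) u has_field_derivative eq3_rhs \<alpha>0 \<alpha>1 t (u t) (p t) (q t)) (at t)"
      by (rule has_field_derivative_transform_within_open[OF dq[OF that] \<open>open S\<close> that])
         (simp add: d2)
    then show ?thesis
      by (simp add: numeral_3_eq_3 numeral_2_eq_2 DERIV_imp_deriv)
  qed
  show "solves_eq3 \<alpha>0 \<alpha>1 S u"
    by (simp add: solves_eq3_def d1 d2 d3)
qed

lemma solves_eq3_iff_rational:
  assumes "open S" and u: "u holomorphic_on S"
  shows "solves_eq3 \<alpha>0 \<alpha>1 S u \<longleftrightarrow>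
    solves_rational_system \<alpha>0 \<alpha>1 S u (deriv u) ((deriv ^^ 2) u)"
proof
  have d: "((deriv ^^ n) u has_field_derivative (deriv ^^ Suc n) u t) (at t)"
    if "t \<in> S" for n t
    using holomorphic_derivI[OF holomorphic_higher_deriv[OF u \<open>open S\<close>] \<open>open S\<close> that, of n]
    by simp
  assume "solves_eq3 \<alpha>0 \<alpha>1 S u"
  then show "solves_rational_system \<alpha>0 \<alpha>1 S u (deriv u) ((deriv ^^ 2) u)"
    unfolding solves_rational_system_def solves_eq3_def
    using d[of _ 0] d[of _ 1] d[of _ 2]
    by (auto simp: numeral_2_eq_2 numeral_3_eq_3)
qed (rule solves_rational_imp_eq3(4)[OF \<open>open S\<close>])

theorem proposition2p1:
  fixes \<alpha>0 \<alpha>1 :: complex and S :: "complex set"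
  assumes "open S" and "0 \<notin> S"
  shows
    "(\<forall>u. u holomorphic_on S \<and> (\<forall>t\<in>S. deriv u t \<noteq> 0) \<longrightarrow>
        (solves_eq3 \<alpha>0 \<alpha>1 S u \<longleftrightarrow>
         solves_polynomial_system \<alpha>0 \<alpha>1 S u (deriv u)
           (\<lambda>t. transf_z \<alpha>0 \<alpha>1 t (u t) (deriv u t) ((deriv ^^ 2) u t))))
   \<and> (\<forall>x y z. solves_polynomial_system \<alpha>0 \<alpha>1 S x y z \<and> (\<forall>t\<in>S. y t \<noteq> 0) \<longrightarrow>
        (\<exists>u. u holomorphic_on S \<and> (\<forall>t\<in>S. deriv u t \<noteq> 0) \<and> solves_eq3 \<alpha>0 \<alpha>1 S u
           \<and> (\<forall>t\<in>S. x t = u t \<and> y t = deriv u t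
                  \<and> z t = transf_z \<alpha>0 \<alpha>1 t (u t) (deriv u t) ((deriv ^^ 2) u t))))
   \<and> (\<forall>u p q. (\<forall>t\<in>S. p t \<noteq> 0) \<longrightarrow>
        (solves_rational_system \<alpha>0 \<alpha>1 S u p q \<longleftrightarrow>
         solves_polynomial_system \<alpha>0 \<alpha>1 S u p (\<lambda>t. transf_z \<alpha>0 \<alpha>1 t (u t) (p t) (q t))))"
proof (intro conjI allI impI)
  have rational: "solves_rational_system \<alpha>0 \<alpha>1 S u p q \<longleftrightarrow>
      solves_polynomial_system \<alpha>0 \<alpha>1 S u p (\<lambda>t. transf_z \<alpha>0 \<alpha>1 t (u t) (p t) (q t))"
    if "\<forall>t\<in>S. p t \<noteq> 0" for u p q
    by (rule solves_rational_iff_polynomial[OF assms])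
       (use that transf_z_eq_iff in blast)+
  {
    fix u p q :: "complex \<Rightarrow> complex"
    assume "\<forall>t\<in>S. p t \<noteq> 0"
    then show "solves_rational_system \<alpha>0 \<alpha>1 S u p q \<longleftrightarrow>
        solves_polynomial_system \<alpha>0 \<alpha>1 S u p (\<lambda>t. transf_z \<alpha>0 \<alpha>1 t (u t) (p t) (q t))"
      by (rule rational)
  next
    fix u :: "complex \<Rightarrow> complex"
    assume "u holomorphic_on S \<and> (\<forall>t\<in>S. deriv u t \<noteq> 0)"
    then show "solves_eq3 \<alpha>0 \<alpha>1 S u \<longleftrightarrow>
        solves_polynomial_system \<alpha>0 \<alpha>1 S u (deriv u)
          (\<lambda>t. transf_z \<alpha>0 \<alpha>1 t (u t) (deriv u t) ((deriv ^^ 2) u t))"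
      using solves_eq3_iff_rational[OF \<open>open S\<close>] rational by blast
  next
    fix x y z :: "complex \<Rightarrow> complex"
    assume *: "solves_polynomial_system \<alpha>0 \<alpha>1 S x y z \<and> (\<forall>t\<in>S. y t \<noteq> 0)"
    \<comment> \<open>the inverse transformation: the value that \<open>y'\<close> takes along the polynomial system\<close>
    define q where "q = (\<lambda>t. y t * z t + ((2 * \<alpha>1 - 1) * x t + \<alpha>0) / t^2)"
    have "solves_rational_system \<alpha>0 \<alpha>1 S x y q"
      using * solves_rational_iff_polynomial[OF assms, of y q z \<alpha>1 x \<alpha>0] by (simp add: q_def)
    note sol = solves_rational_imp_eq3[OF \<open>open S\<close> this]
    have "z t = transf_z \<alpha>0 \<alpha>1 t (x t) (y t) (q t)" if "t \<in> S" for t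
      using * that transf_z_eq_iff[of "y t" \<alpha>0 \<alpha>1 t "x t" "q t" "z t"] by (simp add: q_def)
    then show "\<exists>u. u holomorphic_on S \<and> (\<forall>t\<in>S. deriv u t \<noteq> 0) \<and> solves_eq3 \<alpha>0 \<alpha>1 S u
           \<and> (\<forall>t\<in>S. x t = u t \<and> y t = deriv u t
                  \<and> z t = transf_z \<alpha>0 \<alpha>1 t (u t) (deriv u t) ((deriv ^^ 2) u t))"
      using * sol by (intro exI[of _ x]) simp
  }
qed

end
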